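(* Let $A$ be a finite set and let $\mathbb{P}$ be a probability measure on $A^{\mathbb{N}}$, with coupling matrix $D^\sigma=(D^\sigma_{i,j})_{i,j\in\mathbb{N}}$, $\sigma\in A^{\mathbb N}$. Put $\overline{D}_{i,j}:=\sup_{\sigma\in A^{\mathbb{N}}}D^\sigma_{i,j}$ and assume that $\overline D$ is a bounded operator on $\ell^2(\mathbb{N})$, i.e. $\|\overline{D}\|_{\ell^2(\mathbb{N})}:=\sup\{\|\overline{D}u\|_{\ell^2(\mathbb{N})}: \|u\|_{\ell^2(\mathbb{N})}=1\}<\infty$. Let $n\in\mathbb{N}$ be arbitrary. Then for all functions $g:A^n\to\mathbb{R}$ and all $t>0$, $$\mathbb{P}\left\{|g-\mathbb{E}g|\geq t\right\}\leq 2\exp\left(-\frac{2t^2}{\|\overline{D}\|^2_{\ell^2(\mathbb{N})}\,\|\delta g\|^2_{\ell^2(\mathbb{N})}}\right).$$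
   Context: $\mathbb{N}=\{1,2,\dots\}$. A function $g:A^n\to\mathbb{R}$ is also viewed as a function on $A^{\mathbb{N}}$ depending only on the coordinates $\sigma_1,\dots,\sigma_n$; $\mathbb{E}$ is expectation with respect to $\mathbb{P}$. Variation: $\delta_i g:=\sup\{|g(\sigma)-g(\sigma')|:\sigma_j=\sigma'_j\ \forall j\neq i\}$; $\delta g$ is the vector $(\delta_j g)_{j\in\mathbb{N}}$ (so $\delta_jg=0$ for $j>n$). If $\|\delta g\|_{\ell^2(\mathbb{N})}=0$ the exponential on the right-hand side is read as $0$. Coupling matrix: fix versions of the conditional distributions of the future coordinates given finitely many past ones. For $\sigma\in A^{\mathbb{N}}$, $i\in\mathbb{N}$, $a,b\in A$, let $\mathbb{P}^{\sigma}_{i,a,b}$ (depending on $\sigma$ only through $\sigma_1,\dots,\sigma_{i-1}$) be the maximal coupling of $\mathbb{P}(d\eta_{\geq i+1}\mid\sigma_1,\dots,\sigma_{i-1},\sigma_i=a)$ and $\mathbb{P}(d\eta_{\geq i+1}\mid\sigma_1,\dots,\sigma_{i-1},\sigma_i=b)$, i.e. a (fixed choice of) joint law of a pair $(\sigma^{(1)}_{\ge i+1},\sigma^{(2)}_{\ge i+1})$ with these two marginals for which the probability that the two components coincide is as large as possible. Then $D^\sigma$ is the upper-triangular matrix with $D^\sigma_{ii}:=1$, $D^\sigma_{i,i+j}:=\max_{a,b\in A}\mathbb{P}^{\sigma}_{i,a,b}\{\sigma^{(1)}_{i+j}\neq\sigma^{(2)}_{i+j}\}$ for $j\geq1$, and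 $D^\sigma_{i,k}=0$ for $k<i$. *)

theory Defs
  imports "HOL-Probability.Probability"
begin

text \<open>Coordinates are indexed from 0: index \<open>i\<close> here is coordinate \<open>i + 1\<close> in the
  convention where the natural numbers start at 1. The finite alphabet is a type \<open>'a :: finite\<close>.\<close>

definition seqM :: "(nat \<Rightarrow> 'a::finite) measure" where
  "seqM = PiM UNIV (\<lambda>_. count_space UNIV)"

definition futureM :: "nat \<Rightarrow> (nat \<Rightarrow> 'a::finite) measure" where
  "futureM m = PiM {m..} (\<lambda>_. count_space UNIV)"

definition agree_below :: "nat \<Rightarrow> (nat \<Rightarrow> 'a) \<Rightarrow> (nat \<Rightarrow> 'a) \<Rightarrow> bool" where
  "agree_below m \<sigma> \<sigma>' \<longleftrightarrow> (\<forall>j<m. \<sigma> j = \<sigma>' j)"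

definition depends_below :: "nat \<Rightarrow> ((nat \<Rightarrow> 'a) \<Rightarrow> 'b) \<Rightarrow> bool" where
  "depends_below m f \<longleftrightarrow> (\<forall>\<sigma> \<sigma>'. agree_below m \<sigma> \<sigma>' \<longrightarrow> f \<sigma> = f \<sigma>')"

text \<open>\<open>Q m \<sigma>\<close> is the law of the coordinates \<open>{m..}\<close> given that the first \<open>m\<close> coordinates are those
  of \<open>\<sigma>\<close>. A past of probability zero may be assigned an arbitrary law; this is exactly the freedom
  in choosing a version.\<close>

definition cond_future_versions ::
  "(nat \<Rightarrow> 'a::finite) measure \<Rightarrow> (nat \<Rightarrow> (nat \<Rightarrow> 'a) \<Rightarrow> (nat \<Rightarrow> 'a) measure) \<Rightarrow> bool" where
  "cond_future_versions P Q \<longleftrightarrow>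
     (\<forall>m. depends_below m (Q m) \<and>
       (\<forall>\<sigma>. prob_space (Q m \<sigma>) \<and> sets (Q m \<sigma>) = sets (futureM m) \<and>
         (measure P {\<eta> \<in> space P. agree_below m \<eta> \<sigma>} > 0 \<longrightarrow>
           (\<forall>B \<in> sets (futureM m).
              measure (Q m \<sigma>) B =
                cond_prob P (\<lambda>\<eta>. restrict \<eta> {m..} \<in> B) (\<lambda>\<eta>. agree_below m \<eta> \<sigma>)))))"

definition is_coupling :: "'b measure \<Rightarrow> 'b measure \<Rightarrow> ('b \<times> 'b) measure \<Rightarrow> bool" where
  "is_coupling \<mu> \<nu> K \<longleftrightarrow>
     sets K = sets (\<mu> \<Otimes>\<^sub>M \<nu>) \<and> distr K \<mu> fst = \<mu> \<and> distr K \<nu> snd = \<nu>"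

definition is_maximal_coupling :: "'b measure \<Rightarrow> 'b measure \<Rightarrow> ('b \<times> 'b) measure \<Rightarrow> bool" where
  "is_maximal_coupling \<mu> \<nu> K \<longleftrightarrow>
     is_coupling \<mu> \<nu> K \<and>
     (\<forall>K'. is_coupling \<mu> \<nu> K' \<longrightarrow>
        measure K' {p \<in> space K'. fst p = snd p} \<le> measure K {p \<in> space K. fst p = snd p})"

text \<open>\<open>C i \<sigma> a b\<close> couples the laws of the coordinates after \<open>i\<close>, given the coordinates of \<open>\<sigma>\<close>
  strictly before \<open>i\<close> and the value \<open>a\<close>, respectively \<open>b\<close>, at \<open>i\<close>.\<close>

definition maximal_coupling_choice ::
  "(nat \<Rightarrow> (nat \<Rightarrow> 'a::finite) \<Rightarrow> (nat \<Rightarrow> 'a) measure) \<Rightarrow>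
   (nat \<Rightarrow> (nat \<Rightarrow> 'a) \<Rightarrow> 'a \<Rightarrow> 'a \<Rightarrow> ((nat \<Rightarrow> 'a) \<times> (nat \<Rightarrow> 'a)) measure) \<Rightarrow> bool" where
  "maximal_coupling_choice Q C \<longleftrightarrow>
     (\<forall>i. depends_below i (C i) \<and>
       (\<forall>\<sigma> a b. is_maximal_coupling (Q (Suc i) (\<sigma>(i := a))) (Q (Suc i) (\<sigma>(i := b))) (C i \<sigma> a b)))"

definition coupling_matrix ::
  "(nat \<Rightarrow> (nat \<Rightarrow> 'a::finite) \<Rightarrow> 'a \<Rightarrow> 'a \<Rightarrow> ((nat \<Rightarrow> 'a) \<times> (nat \<Rightarrow> 'a)) measure) \<Rightarrow>
   (nat \<Rightarrow> 'a) \<Rightarrow> nat \<Rightarrow> nat \<Rightarrow> real" where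
  "coupling_matrix C \<sigma> i k =
     (if k < i then 0
      else if k = i then 1
      else Max (range (\<lambda>(a, b).
             measure (C i \<sigma> a b) {p \<in> space (C i \<sigma> a b). fst p k \<noteq> snd p k})))"

definition sup_coupling_matrix ::
  "(nat \<Rightarrow> (nat \<Rightarrow> 'a::finite) \<Rightarrow> 'a \<Rightarrow> 'a \<Rightarrow> ((nat \<Rightarrow> 'a) \<times> (nat \<Rightarrow> 'a)) measure) \<Rightarrow>
   nat \<Rightarrow> nat \<Rightarrow> real" where
  "sup_coupling_matrix C i k = (SUP \<sigma>. coupling_matrix C \<sigma> i k)"

definition l2 :: "(nat \<Rightarrow> real) set" where
  "l2 = {u. summable (\<lambda>i. (u i)\<^sup>2)}"

definition l2_norm :: "(nat \<Rightarrow> real) \<Rightarrow> real" where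
  "l2_norm u = sqrt (\<Sum>i. (u i)\<^sup>2)"

definition mat_apply :: "(nat \<Rightarrow> nat \<Rightarrow> real) \<Rightarrow> (nat \<Rightarrow> real) \<Rightarrow> nat \<Rightarrow> real" where
  "mat_apply M u i = (\<Sum>j. M i j * u j)"

definition l2_bounded :: "(nat \<Rightarrow> nat \<Rightarrow> real) \<Rightarrow> bool" where
  "l2_bounded M \<longleftrightarrow>
     (\<forall>u \<in> l2. (\<forall>i. summable (\<lambda>j. M i j * u j)) \<and> mat_apply M u \<in> l2) \<and>
     bdd_above {l2_norm (mat_apply M u) | u. u \<in> l2 \<and> l2_norm u = 1}"

definition l2_opnorm :: "(nat \<Rightarrow> nat \<Rightarrow> real) \<Rightarrow> real" where
  "l2_opnorm M = Sup {l2_norm (mat_apply M u) | u. u \<in> l2 \<and> l2_norm u = 1}"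

definition variation :: "((nat \<Rightarrow> 'a) \<Rightarrow> real) \<Rightarrow> nat \<Rightarrow> real" where
  "variation g i = Sup {\<bar>g \<sigma> - g \<sigma>'\<bar> | \<sigma> \<sigma>'. \<forall>j. j \<noteq> i \<longrightarrow> \<sigma> j = \<sigma>' j}"

end

theory Submission
  imports Defs
begin

text \<open>
  The increments of the martingale \<open>\<E>[g | \<sigma>\<^sub>0, \<dots>, \<sigma>\<^sub>m\<^sub>-\<^sub>1]\<close> are controlled by the coupling matrix: changing
  the value at coordinate \<open>i\<close> and coupling the two futures changes the conditional expectation by at
  most \<open>\<Sum>k. D i k * \<delta>\<^sub>k g\<close>. Hoeffding's lemma, applied to one increment at a time, then bounds the
  moment generating function of \<open>g - \<E> g\<close> in terms of \<open>\<parallel>D \<delta>g\<parallel>\<^sup>2\<close>, and Chernoff's bound concludes.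
\<close>

subsection \<open>Functions of finitely many coordinates\<close>

text \<open>This factors \<open>f\<close> through the list of the first \<open>n\<close>
  coordinates. Over a finite alphabet there are finitely many lists of length \<open>n\<close>, and
  all lists form a countable type; the former gives finite range, the latter measurability. The
  padding \<open>undefined\<close> sits only at coordinates that \<open>f\<close> ignores.\<close>

lemma depends_below_eq_list:
  assumes "depends_below n f"
  shows "f \<sigma> = f (\<lambda>i. if i < n then map \<sigma> [0..<n] ! i else undefined)"
  using assms by (auto simp: depends_below_def agree_below_def)

lemma finite_range_depends_below:
  fixes f :: "(nat \<Rightarrow> 'a::finite) \<Rightarrow> 'b"
  assumes "depends_below n f"
  shows "finite (range f)"
proof -
  have "range f \<subseteq> (\<lambda>xs. f (\<lambda>i. if i < n then xs ! i else undefined)) ` {xs. set xs \<subseteq> UNIV \<and> length xs = n}"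
  proof (rule image_subsetI)
    show "f \<sigma> \<in> (\<lambda>xs. f (\<lambda>i. if i < n then xs ! i else undefined)) ` {xs. set xs \<subseteq> UNIV \<and> length xs = n}" for \<sigma>
      by (rule image_eqI[where x = "map \<sigma> [0..<n]"]) (rule depends_below_eq_list[OF assms], simp)
  qed
  then show ?thesis
    by (rule finite_surj[OF finite_lists_length_eq[OF finite]])
qed

text \<open>The prefix takes countably many values, so it suffices to treat appending one coordinate
  to each fixed prefix.\<close>

lemma measurable_map_upt:
  fixes X :: "'b \<Rightarrow> nat \<Rightarrow> 'a::countable"
  assumes "\<And>j. j < n \<Longrightarrow> (\<lambda>x. X x j) \<in> measurable M (count_space UNIV)"
  shows "(\<lambda>x. map (X x) [0..<n]) \<in> measurable M (count_space UNIV)"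
  using assms
proof (induction n)
  case (Suc n)
  have "(\<lambda>x. (\<lambda>xs x. xs @ [X x n]) (map (X x) [0..<n]) x) \<in> measurable M (count_space UNIV)"
  proof (rule measurable_compose_countable[where f = "\<lambda>xs x. xs @ [X x n]"])
    show "(\<lambda>x. xs @ [X x n]) \<in> measurable M (count_space UNIV)" for xs
      using Suc.prems[of n] by (rule measurable_compose) auto
    show "(\<lambda>x. map (X x) [0..<n]) \<in> measurable M (count_space UNIV)"
      using Suc.prems by (intro Suc.IH) auto
  qed
  then show ?case by simp
qed auto

text \<open>An arbitrary random sequence \<open>X\<close> is allowed so that the lemma also covers a
  fixed past spliced with a random future.\<close>

lemma measurable_depends_below:
  fixes X :: "'b \<Rightarrow> nat \<Rightarrow> 'a::finite"
  assumes "depends_below n f" "\<And>j. j < n \<Longrightarrow> (\<lambda>x. X x j) \<in> measurable M (count_space UNIV)"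
    and "space N = UNIV"
  shows "(\<lambda>x. f (X x)) \<in> measurable M N"
proof -
  have "(\<lambda>x. (\<lambda>xs. f (\<lambda>i. if i < n then xs ! i else undefined)) (map (X x) [0..<n])) \<in> measurable M N"
    by (rule measurable_compose[OF measurable_map_upt[of n X]]) (use assms in auto)
  then show ?thesis
    by (simp only: depends_below_eq_list[OF assms(1), symmetric])
qed

lemma depends_below_abs_bound:
  fixes f :: "(nat \<Rightarrow> 'a::finite) \<Rightarrow> real"
  assumes "depends_below n f"
  obtains B where "\<And>\<sigma>. \<bar>f \<sigma>\<bar> \<le> B"
proof -
  have "finite (range (\<lambda>\<sigma>. \<bar>f \<sigma>\<bar>))"
    using finite_imageI[OF finite_range_depends_below[OF assms], of abs] by (simp add: image_image)
  then have "\<bar>f \<sigma>\<bar> \<le> Max (range (\<lambda>\<sigma>. \<bar>f \<sigma>\<bar>))" for \<sigma> by (rule Max_ge) simp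
  then show ?thesis by (rule that)
qed

subsection \<open>Variations\<close>

text \<open>A real supremum dominates its members once the set is bounded above; here the finite
  range of \<open>g\<close> bounds it.\<close>

lemma diff_le_variation:
  fixes g :: "(nat \<Rightarrow> 'a::finite) \<Rightarrow> real"
  assumes "depends_below n g" "\<And>j. j \<noteq> i \<Longrightarrow> \<sigma> j = \<sigma>' j"
  shows "\<bar>g \<sigma> - g \<sigma>'\<bar> \<le> variation g i"
proof -
  obtain B where B: "\<And>\<sigma>. \<bar>g \<sigma>\<bar> \<le> B" using depends_below_abs_bound[OF assms(1)] by blast
  have *: "\<bar>g \<sigma> - g \<sigma>'\<bar> \<le> 2 * B" for \<sigma> \<sigma>' using B[of \<sigma>] B[of \<sigma>'] by linarith
  show ?thesis unfolding variation_def
  proof (rule cSup_upper)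
    show "bdd_above {\<bar>g \<sigma> - g \<sigma>'\<bar> |\<sigma> \<sigma>'. \<forall>j. j \<noteq> i \<longrightarrow> \<sigma> j = \<sigma>' j}"
      using * by (auto simp: bdd_above_def)
    show "\<bar>g \<sigma> - g \<sigma>'\<bar> \<in> {\<bar>g \<sigma> - g \<sigma>'\<bar> |\<sigma> \<sigma>'. \<forall>j. j \<noteq> i \<longrightarrow> \<sigma> j = \<sigma>' j}"
    proof (rule CollectI, rule exI[of _ \<sigma>], rule exI[of _ \<sigma>'], rule conjI[OF refl])
      show "\<forall>j. j \<noteq> i \<longrightarrow> \<sigma> j = \<sigma>' j" using assms(2) by (intro allI impI)
    qed
  qed
qed

lemma variation_nonneg:
  fixes g :: "(nat \<Rightarrow> 'a::finite) \<Rightarrow> real"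
  assumes "depends_below n g"
  shows "variation g i \<ge> 0"
  using diff_le_variation[OF assms, where i = i and \<sigma> = undefined and \<sigma>' = undefined] by simp

lemma variation_eq_0:
  fixes g :: "(nat \<Rightarrow> 'a::finite) \<Rightarrow> real"
  assumes "depends_below n g" "i \<ge> n"
  shows "variation g i = 0"
proof -
  have "g \<sigma> = g \<sigma>'" if "\<forall>j. j \<noteq> i \<longrightarrow> \<sigma> j = \<sigma>' j" for \<sigma> \<sigma>'
    using assms that unfolding depends_below_def agree_below_def by (metis leD)
  then have "{\<bar>g \<sigma> - g \<sigma>'\<bar> |\<sigma> \<sigma>'. \<forall>j. j \<noteq> i \<longrightarrow> \<sigma> j = \<sigma>' j} = {0}" by fastforce
  then show ?thesis by (simp add: variation_def)
qed

lemma variation_uminus: "variation (\<lambda>\<sigma>. - g \<sigma>) = variation g"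
  by (simp add: variation_def fun_eq_iff abs_minus_commute)

text \<open>Replace the coordinates of \<open>x\<close> by those of \<open>y\<close> one at a time:
  step \<open>k\<close> costs at most the variation at \<open>k\<close>, and nothing where the
  sequences agree.\<close>

lemma diff_le_sum_variation:
  fixes g :: "(nat \<Rightarrow> 'a::finite) \<Rightarrow> real"
  assumes "depends_below n g"
  shows "g x - g y \<le> (\<Sum>k<n. variation g k * of_bool (x k \<noteq> y k))"
proof -
  \<comment> \<open>The hybrids run from \<open>z 0 = x\<close> to \<open>z n\<close>, which
    \<open>g\<close> cannot distinguish from \<open>y\<close>.\<close>
  define z where "z m = (\<lambda>j. if j < m then y j else x j)" for m :: nat
  have "g x - g (z m) \<le> (\<Sum>k<m. variation g k * of_bool (x k \<noteq> y k))" for m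
  proof (induction m)
    case 0
    then show ?case by (simp add: z_def)
  next
    case (Suc m)
    have "g (z m) - g (z (Suc m)) \<le> variation g m * of_bool (x m \<noteq> y m)"
    proof (cases "x m = y m")
      case True
      then have "z m = z (Suc m)" by (auto simp: z_def less_Suc_eq)
      with True show ?thesis by simp
    next
      case False
      then show ?thesis
        using diff_le_variation[OF assms, of m "z m" "z (Suc m)"] by (auto simp: z_def less_Suc_eq)
    qed
    with Suc show ?case by simp
  qed
  moreover have "g (z n) = g y"
    using assms by (auto simp: z_def depends_below_def agree_below_def)
  ultimately show ?thesis by metis
qed

subsection \<open>Hoeffding's lemma for finite weights\<close>

text \<open>Dividing by the total weight reduces this to Hoeffding's lemma for a random letter. The
  weights stay unnormalised because they will be the probabilities of the one-letter extensions of a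
  cylinder. The oscillation is restricted to positive weights because conditional means are
  meaningless on null cylinders.\<close>

lemma weighted_Hoeffdings_lemma:
  fixes w x :: "'a::finite \<Rightarrow> real"
  assumes w: "\<And>a. w a \<ge> 0" and pos: "(\<Sum>a\<in>UNIV. w a) > 0" and mean: "(\<Sum>a\<in>UNIV. w a * x a) = 0"
    and osc: "\<And>a b. w a > 0 \<Longrightarrow> w b > 0 \<Longrightarrow> x a - x b \<le> c" and l: "l > 0"
  shows "(\<Sum>a\<in>UNIV. w a * exp (l * x a)) \<le> (\<Sum>a\<in>UNIV. w a) * exp (l\<^sup>2 * c\<^sup>2 / 8)"
proof -
  define W where "W = (\<Sum>a\<in>UNIV. w a)"
  have W: "W > 0" using pos by (simp add: W_def)
  define p where "p = embed_pmf (\<lambda>a. w a / W)"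
  have pmf_p: "pmf p a = w a / W" for a unfolding p_def
  proof (rule pmf_embed_pmf)
    show "(\<integral>\<^sup>+ x. ennreal (w x / W) \<partial>count_space UNIV) = 1"
      using W w by (simp add: nn_integral_count_space_finite sum_ennreal flip: sum_divide_distrib W_def)
  qed (use W w in simp)
  have in_supp: "w a > 0" if "a \<in> set_pmf p" for a
    using that W w[of a] by (auto simp: set_pmf_eq pmf_p order_less_le)
  \<comment> \<open>The interval from \<open>Min S\<close> to \<open>Max S\<close> is the smallest
    one containing the values on the support. Its length is a difference of two such values, so
    \<open>osc\<close> bounds it by \<open>c\<close>.\<close>
  define S where "S = x ` set_pmf p"
  have S: "finite S" "S \<noteq> {}" by (auto simp: S_def set_pmf_not_empty)
  have "x a \<in> {Min S..Max S}" if "a \<in> set_pmf p" for a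
    using that S by (auto simp: S_def)
  then interpret interval_bounded_random_variable "measure_pmf p" x "Min S" "Max S"
    by unfold_locales (auto simp: AE_measure_pmf_iff)
  have int_p: "measure_pmf.expectation p f = (\<Sum>a\<in>UNIV. w a * f a) / W" for f :: "'a \<Rightarrow> real"
    by (subst integral_measure_pmf[of UNIV]) (auto simp: pmf_p sum_divide_distrib)
  have "Min S \<in> S" "Max S \<in> S" using S by auto
  then have "Max S - Min S \<le> c" using osc in_supp by (auto simp: S_def)
  moreover have "Min S \<le> Max S" using S by simp
  ultimately have sq: "(Max S - Min S)\<^sup>2 \<le> c\<^sup>2" by (intro power_mono) auto
  have int: "integrable (measure_pmf p) f" for f :: "'a \<Rightarrow> real"
    by (rule integrable_measure_pmf_finite) simp
  have "ennreal (measure_pmf.expectation p (\<lambda>a. exp (l * x a))) \<le> ennreal (exp (l\<^sup>2 * (Max S - Min S)\<^sup>2 / 8))"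
    using Hoeffdings_lemma_nn_integral_0[OF l] mean int by (simp add: int_p nn_integral_eq_integral)
  also have "\<dots> \<le> ennreal (exp (l\<^sup>2 * c\<^sup>2 / 8))"
    using sq by (intro ennreal_leI) (simp add: mult_left_mono)
  finally have "measure_pmf.expectation p (\<lambda>a. exp (l * x a)) \<le> exp (l\<^sup>2 * c\<^sup>2 / 8)"
    by simp
  then show ?thesis using W by (simp add: int_p field_simps W_def)
qed

subsection \<open>Conditional means on cylinders\<close>

definition cylinder :: "nat \<Rightarrow> (nat \<Rightarrow> 'a) \<Rightarrow> (nat \<Rightarrow> 'a) set" where
  "cylinder m \<sigma> = {\<eta>. agree_below m \<eta> \<sigma>}"

text \<open>On a cylinder of probability zero the conditional mean is the junk value \<open>0\<close>.\<close>

definition cond_mean :: "(nat \<Rightarrow> 'a) measure \<Rightarrow> ((nat \<Rightarrow> 'a) \<Rightarrow> real) \<Rightarrow> nat \<Rightarrow> (nat \<Rightarrow> 'a) \<Rightarrow> real" where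
  "cond_mean P g m \<sigma> = (\<integral>\<eta>. g \<eta> * indicator (cylinder m \<sigma>) \<eta> \<partial>P) / measure P (cylinder m \<sigma>)"

lemma depends_below_cylinder: "depends_below m (\<lambda>\<eta>. \<eta> \<in> cylinder m \<sigma>)"
  by (auto simp: depends_below_def cylinder_def agree_below_def)

lemma depends_below_cylinder_eq: "depends_below m f \<Longrightarrow> \<eta> \<in> cylinder m \<sigma> \<Longrightarrow> f \<eta> = f \<sigma>"
  unfolding depends_below_def cylinder_def by blast

text \<open>Among the one-letter extensions only the one with \<open>a = \<eta> m\<close> can
  contain \<eta>.\<close>

lemma indicator_cylinder_split:
  fixes \<sigma> :: "nat \<Rightarrow> 'a::finite"
  shows "indicator (cylinder m \<sigma>) \<eta> =
    (\<Sum>a\<in>UNIV. indicator (cylinder (Suc m) (\<sigma>(m := a))) \<eta> :: real)"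
proof -
  have "indicator (cylinder (Suc m) (\<sigma>(m := a))) \<eta> =
      (if a = \<eta> m then indicator (cylinder m \<sigma>) \<eta> else 0 :: real)" for a
    by (auto simp: cylinder_def agree_below_def indicator_def less_Suc_eq)
  then show ?thesis by simp
qed

locale seq_prob_space = prob_space P for P :: "(nat \<Rightarrow> 'a::finite) measure" +
  assumes sets_P: "sets P = sets seqM"
begin

lemma space_P: "space P = UNIV"
  using sets_eq_imp_space_eq[OF sets_P] by (simp add: seqM_def space_PiM)

lemma measurable_P: "measurable P N = measurable seqM N"
  using sets_P by (rule measurable_cong_sets) simp

lemma measurable_coord: "(\<lambda>\<eta>. \<eta> j) \<in> measurable P (count_space UNIV)"
  unfolding measurable_P seqM_def by (rule measurable_component_singleton) simp

lemma borel_measurable_P: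
  fixes f :: "(nat \<Rightarrow> 'a) \<Rightarrow> real"
  assumes "depends_below n f"
  shows "f \<in> borel_measurable P"
  using measurable_depends_below[OF assms, where X = "\<lambda>\<eta>. \<eta>" and M = P and N = borel] measurable_coord by simp

lemma cylinder_sets: "cylinder m \<sigma> \<in> sets P"
proof -
  have "(\<lambda>\<eta>. \<eta> \<in> cylinder m \<sigma>) \<in> measurable P (count_space UNIV)"
    using measurable_depends_below[OF depends_below_cylinder, where X = "\<lambda>\<eta>. \<eta>" and M = P and N = "count_space UNIV"]
      measurable_coord by simp
  then show ?thesis by (simp add: space_P pred_def)
qed

lemma integrable_P:
  fixes f :: "(nat \<Rightarrow> 'a) \<Rightarrow> real"
  assumes "depends_below n f"
  shows "integrable P f"
proof -
  obtain B where "\<And>\<sigma>. \<bar>f \<sigma>\<bar> \<le> B" using depends_below_abs_bound[OF assms] by blast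
  then show ?thesis
    using borel_measurable_P[OF assms] by (intro integrable_const_bound[where B = B] AE_I2) (simp_all only: real_norm_def)
qed

lemma integrable_mult_indicator_cylinder:
  fixes f :: "(nat \<Rightarrow> 'a) \<Rightarrow> real"
  assumes "depends_below n f"
  shows "integrable P (\<lambda>\<eta>. f \<eta> * indicator (cylinder m \<sigma>) \<eta>)"
  using integrable_P[OF assms] cylinder_sets by (rule integrable_real_mult_indicator[rotated])

lemma integral_cylinder_split:
  fixes f :: "(nat \<Rightarrow> 'a) \<Rightarrow> real"
  assumes "depends_below n f"
  shows "(\<integral>\<eta>. f \<eta> * indicator (cylinder m \<sigma>) \<eta> \<partial>P) =
    (\<Sum>a\<in>UNIV. \<integral>\<eta>. f \<eta> * indicator (cylinder (Suc m) (\<sigma>(m := a))) \<eta> \<partial>P)"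
  unfolding indicator_cylinder_split[of m \<sigma>] sum_distrib_left
  by (rule Bochner_Integration.integral_sum) (rule integrable_mult_indicator_cylinder[OF assms])

lemma prob_cylinder_split:
  "prob (cylinder m \<sigma>) = (\<Sum>a\<in>UNIV. prob (cylinder (Suc m) (\<sigma>(m := a))))"
  using integral_cylinder_split[of 0 "\<lambda>_. 1" m \<sigma>] cylinder_sets by (simp add: depends_below_def space_P)

lemma integral_cylinder_null:
  fixes f :: "(nat \<Rightarrow> 'a) \<Rightarrow> real"
  assumes "prob (cylinder m \<sigma>) = 0"
  shows "(\<integral>\<eta>. f \<eta> * indicator (cylinder m \<sigma>) \<eta> \<partial>P) = 0"
proof (rule integral_eq_zero_AE)
  have "cylinder m \<sigma> \<in> null_sets P"
    using assms cylinder_sets[of m \<sigma>] by (intro null_setsI) (simp_all add: emeasure_eq_measure)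
  then have "AE \<eta> in P. \<eta> \<notin> cylinder m \<sigma>"
    by (rule AE_not_in)
  then show "AE \<eta> in P. f \<eta> * indicator (cylinder m \<sigma>) \<eta> = 0"
    by (rule eventually_mono) simp
qed

text \<open>In product form the identity also holds on null cylinders, where both sides vanish
  whatever the junk value is.\<close>

lemma integral_cylinder_eq_cond_mean:
  "(\<integral>\<eta>. g \<eta> * indicator (cylinder m \<sigma>) \<eta> \<partial>P) = prob (cylinder m \<sigma>) * cond_mean P g m \<sigma>"
  by (cases "prob (cylinder m \<sigma>) = 0") (simp_all add: cond_mean_def integral_cylinder_null)

text \<open>Downward induction from \<open>m = n\<close>, where \<open>g\<close> is constant on the
  cylinder. Each step back averages over one more letter and gains one Hoeffding factor
  \<open>exp (l\<^sup>2 * (c m)\<^sup>2 / 8)\<close>. Integrals over cylinders replace conditional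
  expectations, so null cylinders need no exclusion.\<close>

lemma mgf_cylinder_bound:
  fixes c :: "nat \<Rightarrow> real"
  assumes g: "depends_below n g" and l: "l > 0"
    and osc: "\<And>i \<sigma> a b. i < n \<Longrightarrow> prob (cylinder (Suc i) (\<sigma>(i := a))) > 0 \<Longrightarrow>
      prob (cylinder (Suc i) (\<sigma>(i := b))) > 0 \<Longrightarrow>
      cond_mean P g (Suc i) (\<sigma>(i := a)) - cond_mean P g (Suc i) (\<sigma>(i := b)) \<le> c i"
    and "m \<le> n"
  shows "(\<integral>\<eta>. exp (l * (g \<eta> - cond_mean P g m \<sigma>)) * indicator (cylinder m \<sigma>) \<eta> \<partial>P)
    \<le> prob (cylinder m \<sigma>) * exp (l\<^sup>2 * (\<Sum>i\<in>{m..<n}. (c i)\<^sup>2) / 8)"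
  using \<open>m \<le> n\<close>
proof (induction arbitrary: \<sigma> rule: inc_induct)
  case base
  have g_eq: "g \<eta> * indicator (cylinder n \<sigma>) \<eta> = g \<sigma> * indicator (cylinder n \<sigma>) \<eta>" for \<eta>
    using depends_below_cylinder_eq[OF g, of \<eta> \<sigma>] by (simp add: indicator_def)
  show ?case
  \<comment> \<open>On a null cylinder the conditional mean need not be \<open>g \<sigma>\<close>,
    but both sides are 0; otherwise the exponent vanishes on the cylinder.\<close>
  proof (cases "prob (cylinder n \<sigma>) = 0")
    case True
    then show ?thesis by (simp add: integral_cylinder_null)
  next
    case False
    then have "cond_mean P g n \<sigma> = g \<sigma>"
      using cylinder_sets by (simp add: cond_mean_def g_eq space_P)
    then have eq: "exp (l * (g \<eta> - cond_mean P g n \<sigma>)) * indicator (cylinder n \<sigma>) \<eta>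
        = indicator (cylinder n \<sigma>) \<eta>" for \<eta>
      using depends_below_cylinder_eq[OF g, of \<eta> \<sigma>] by (simp add: indicator_def)
    show ?thesis
      unfolding eq using cylinder_sets by (simp add: space_P)
  qed
next
  case (step m)
  define w where "w a = prob (cylinder (Suc m) (\<sigma>(m := a)))" for a
  define E where "E a = cond_mean P g (Suc m) (\<sigma>(m := a))" for a
  define E0 where "E0 = cond_mean P g m \<sigma>"
  define T where "T = exp (l\<^sup>2 * (\<Sum>i\<in>{Suc m..<n}. (c i)\<^sup>2) / 8)"
  have W: "prob (cylinder m \<sigma>) = (\<Sum>a\<in>UNIV. w a)"
    unfolding w_def by (rule prob_cylinder_split)
  have dep: "depends_below n (\<lambda>\<eta>. exp (l * (g \<eta> - e)))" for e
    using g by (auto simp: depends_below_def)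
  have "(\<integral>\<eta>. exp (l * (g \<eta> - E0)) * indicator (cylinder m \<sigma>) \<eta> \<partial>P) =
      (\<Sum>a\<in>UNIV. \<integral>\<eta>. exp (l * (g \<eta> - E0)) * indicator (cylinder (Suc m) (\<sigma>(m := a))) \<eta> \<partial>P)"
    by (rule integral_cylinder_split[OF dep])
  \<comment> \<open>Recentring each extension at its own mean isolates the martingale increment
    \<open>E a - E0\<close> and leaves an integral of the form handled by the induction
    hypothesis.\<close>
  also have "\<dots> = (\<Sum>a\<in>UNIV. exp (l * (E a - E0)) *
      (\<integral>\<eta>. exp (l * (g \<eta> - E a)) * indicator (cylinder (Suc m) (\<sigma>(m := a))) \<eta> \<partial>P))"
  proof (intro sum.cong refl)
    fix a
    have "exp (l * (g \<eta> - E0)) = exp (l * (E a - E0)) * exp (l * (g \<eta> - E a))" for \<eta>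
      by (simp add: exp_add[symmetric] algebra_simps)
    then show "(\<integral>\<eta>. exp (l * (g \<eta> - E0)) * indicator (cylinder (Suc m) (\<sigma>(m := a))) \<eta> \<partial>P) =
        exp (l * (E a - E0)) *
        (\<integral>\<eta>. exp (l * (g \<eta> - E a)) * indicator (cylinder (Suc m) (\<sigma>(m := a))) \<eta> \<partial>P)"
      by (simp only: mult.assoc integral_mult_right_zero)
  qed
  also have "\<dots> \<le> (\<Sum>a\<in>UNIV. exp (l * (E a - E0)) * (w a * T))"
    unfolding w_def E_def T_def by (intro sum_mono mult_left_mono step.IH) simp
  also have "\<dots> = (\<Sum>a\<in>UNIV. w a * exp (l * (E a - E0))) * T"
    by (simp add: sum_distrib_left mult_ac)
  also have "\<dots> \<le> prob (cylinder m \<sigma>) * exp (l\<^sup>2 * (c m)\<^sup>2 / 8) * T"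
  proof (rule mult_right_mono)
    show "(\<Sum>a\<in>UNIV. w a * exp (l * (E a - E0))) \<le> prob (cylinder m \<sigma>) * exp (l\<^sup>2 * (c m)\<^sup>2 / 8)"
    proof (cases "prob (cylinder m \<sigma>) = 0")
      case True
      \<comment> \<open>A null cylinder has only null extensions.\<close>
      then have "w a = 0" for a
        using W by (metis (mono_tags, lifting) UNIV_I finite measure_nonneg sum_nonneg_eq_0_iff w_def)
      then show ?thesis using True by simp
    next
      case False
      \<comment> \<open>Tower property: the means of the extensions average to the mean of the
        cylinder, so the increments are centred as Hoeffding's lemma requires.\<close>
      have "(\<Sum>a\<in>UNIV. w a * E a) = prob (cylinder m \<sigma>) * E0"
        using integral_cylinder_split[OF g, of m \<sigma>]
        by (simp add: integral_cylinder_eq_cond_mean w_def E_def E0_def)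
      then have "(\<Sum>a\<in>UNIV. w a * (E a - E0)) = 0"
        by (simp add: right_diff_distrib sum_subtractf W sum_distrib_right)
      moreover have "(\<Sum>a\<in>UNIV. w a) > 0"
        using False W by (metis measure_nonneg order_less_le)
      ultimately show ?thesis
        unfolding W
        by (intro weighted_Hoeffdings_lemma l)
           (use osc[OF \<open>m < n\<close>] in \<open>auto simp: w_def E_def\<close>)
    qed
  qed (simp add: T_def)
  also have "\<dots> = prob (cylinder m \<sigma>) * exp (l\<^sup>2 * (\<Sum>i\<in>{m..<n}. (c i)\<^sup>2) / 8)"
    using \<open>m < n\<close>
    by (simp add: T_def sum.atLeast_Suc_lessThan exp_add[symmetric] algebra_simps add_divide_distrib)
  finally show ?case by (simp add: E0_def)
qed

subsection \<open>Conditional laws of the future\<close>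

text \<open>A future is a function on the coordinates from \<open>m\<close> on, so the past of
  \<sigma> is spliced in before applying \<open>g\<close>. With a past of positive probability, the
  conditional law is determined: it is \<open>P\<close> conditioned on the cylinder, pushed forward
  by restriction.\<close>

lemma integral_future_eq_cond_mean:
  assumes Q: "cond_future_versions P Q" and g: "depends_below n g"
    and pos: "prob (cylinder m \<sigma>) > 0"
  shows "(\<integral>\<eta>. g (\<lambda>j. if j < m then \<sigma> j else \<eta> j) \<partial>Q m \<sigma>) = cond_mean P g m \<sigma>"
proof -
  define U where "U = uniform_measure P (cylinder m \<sigma>)"
  let ?r = "\<lambda>\<eta>. restrict \<eta> {m..}"
  let ?h = "\<lambda>\<eta>. g (\<lambda>j. if j < m then \<sigma> j else \<eta> j)"
  have cyl: "{\<eta> \<in> space P. agree_below m \<eta> \<sigma>} = cylinder m \<sigma>"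
    by (simp add: space_P cylinder_def)
  interpret U: prob_space U
    unfolding U_def using pos
    by (intro prob_space_uniform_measure) (auto simp: emeasure_eq_measure)
  have setsQ: "sets (Q m \<sigma>) = sets (futureM m)" and probQ: "prob_space (Q m \<sigma>)"
    and condQ: "\<And>B. B \<in> sets (futureM m) \<Longrightarrow> measure (Q m \<sigma>) B =
        cond_prob P (\<lambda>\<eta>. restrict \<eta> {m..} \<in> B) (\<lambda>\<eta>. agree_below m \<eta> \<sigma>)"
    using Q pos cyl by (auto simp: cond_future_versions_def)
  interpret Qm: prob_space "Q m \<sigma>" by (rule probQ)
  have r: "?r \<in> measurable P (futureM m)"
    unfolding measurable_P seqM_def futureM_def by (rule measurable_restrict_subset) simp
  then have rU: "?r \<in> measurable U (futureM m)"
    by (simp add: U_def)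
  have "Q m \<sigma> = distr U (futureM m) ?r"
  proof (rule measure_eqI)
    fix B assume "B \<in> sets (Q m \<sigma>)"
    then have B: "B \<in> sets (futureM m)" by (simp add: setsQ)
    interpret D: prob_space "distr U (futureM m) ?r" by (rule U.prob_space_distr[OF rU])
    have "measure (distr U (futureM m) ?r) B = measure U (?r -` B \<inter> space U)"
      by (rule measure_distr[OF rU B])
    also have "\<dots> = prob (cylinder m \<sigma> \<inter> (?r -` B \<inter> space P)) / prob (cylinder m \<sigma>)"
      using measurable_sets[OF r B] cylinder_sets pos unfolding U_def
      by (subst measure_uniform_measure) (auto simp: emeasure_eq_measure)
    also have "cylinder m \<sigma> \<inter> (?r -` B \<inter> space P) = {\<eta> \<in> space P. ?r \<eta> \<in> B \<and> agree_below m \<eta> \<sigma>}"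
      by (auto simp: cylinder_def)
    also have "prob \<dots> / prob (cylinder m \<sigma>) = measure (Q m \<sigma>) B"
      by (simp add: condQ[OF B] cond_prob_def cyl)
    finally show "emeasure (Q m \<sigma>) B = emeasure (distr U (futureM m) ?r) B"
      by (simp only: Qm.emeasure_eq_measure D.emeasure_eq_measure)
  qed (simp add: setsQ)
  moreover have "?h \<in> borel_measurable (futureM m)"
  proof (rule measurable_depends_below[OF g])
    show "(\<lambda>\<eta>. if j < m then \<sigma> j else \<eta> j) \<in> measurable (futureM m) (count_space UNIV)" for j
      by (cases "j < m") (auto simp: futureM_def intro!: measurable_component_singleton)
  qed simp
  ultimately have "(\<integral>\<eta>. ?h \<eta> \<partial>Q m \<sigma>) = (\<integral>\<eta>. ?h (?r \<eta>) \<partial>U)"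
    using integral_distr[OF rU] by simp
  also have "\<dots> = (\<integral>\<eta>. indicator (cylinder m \<sigma>) \<eta> / prob (cylinder m \<sigma>) * ?h (?r \<eta>) \<partial>P)"
  proof -
    have "U = density P (\<lambda>\<eta>. ennreal (indicator (cylinder m \<sigma>) \<eta> / prob (cylinder m \<sigma>)))"
      unfolding U_def uniform_measure_def using pos
      by (intro arg_cong2[where f = density] ext refl)
         (auto simp: indicator_def emeasure_eq_measure divide_ennreal simp flip: ennreal_1)
    moreover have "(\<lambda>\<eta>. ?h (?r \<eta>)) \<in> borel_measurable P"
      using r \<open>?h \<in> borel_measurable (futureM m)\<close> by (rule measurable_compose)
    ultimately show ?thesis
      using cylinder_sets by (simp add: integral_real_density)
  qed
  also have "\<dots> = (\<integral>\<eta>. g \<eta> * indicator (cylinder m \<sigma>) \<eta> / prob (cylinder m \<sigma>) \<partial>P)"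
  proof (intro Bochner_Integration.integral_cong refl)
    fix \<eta>
    have "?h (?r \<eta>) = g \<eta>" if "\<eta> \<in> cylinder m \<sigma>"
      \<comment> \<open>On the cylinder \<eta> has the past of \<sigma>, so splicing that past onto
        the restricted \<eta> restores \<eta>.\<close>
      using that by (intro arg_cong[where f = g]) (auto simp: cylinder_def agree_below_def)
    then show "indicator (cylinder m \<sigma>) \<eta> / prob (cylinder m \<sigma>) * ?h (?r \<eta>) =
        g \<eta> * indicator (cylinder m \<sigma>) \<eta> / prob (cylinder m \<sigma>)"
      by (auto simp: indicator_def)
  qed
  also have "\<dots> = cond_mean P g m \<sigma>" by (simp add: cond_mean_def)
  finally show ?thesis .
qed

end

section \<open>Couplings of two futures and oscillation of the conditional mean\<close>

lemma prob_space_coupling: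
  assumes "prob_space \<mu>" "is_coupling \<mu> \<nu> K"
  shows "prob_space K"
proof
  interpret \<mu>: prob_space \<mu> by fact
  have K: "sets K = sets (\<mu> \<Otimes>\<^sub>M \<nu>)" "distr K \<mu> fst = \<mu>" using assms by (auto simp: is_coupling_def)
  have "fst \<in> measurable K \<mu>" using measurable_cong_sets[OF K(1) refl] measurable_fst by blast
  \<comment> \<open>The total mass is read off the first marginal, since \<open>fst\<close> maps all
    of \<open>space K\<close> into \<open>space \<mu>\<close>.\<close>
  then have "emeasure (distr K \<mu> fst) (space \<mu>) = emeasure K (space K)"
    by (subst emeasure_distr) (auto dest: measurable_space intro!: arg_cong[where f = "emeasure K"])
  then show "emeasure K (space K) = 1" using K(2) by (simp add: \<mu>.emeasure_space_1)
qed

text \<open>Both integrals become integrals over \<open>K\<close> through its marginals, and the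
  integrands are compared pointwise by the hybrid argument. Past coordinates coincide, coordinate
  \<open>i\<close> costs at most its full variation, and a later \<open>k\<close> costs its
  variation only where the coupled futures disagree at \<open>k\<close>.\<close>

lemma coupling_integral_diff_le:
  fixes g :: "(nat \<Rightarrow> 'a::finite) \<Rightarrow> real"
  assumes \<mu>: "prob_space \<mu>" "sets \<mu> = sets (futureM (Suc i))"
    and \<nu>: "prob_space \<nu>" "sets \<nu> = sets (futureM (Suc i))"
    and K: "is_coupling \<mu> \<nu> K" and g: "depends_below n g" and "i < n"
  shows "(\<integral>\<eta>. g (\<lambda>j. if j < Suc i then (\<sigma>(i := a)) j else \<eta> j) \<partial>\<mu>)
      - (\<integral>\<eta>. g (\<lambda>j. if j < Suc i then (\<sigma>(i := b)) j else \<eta> j) \<partial>\<nu>)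
    \<le> variation g i + (\<Sum>k\<in>{i<..<n}. measure K {p \<in> space K. fst p k \<noteq> snd p k} * variation g k)"
proof -
  interpret K: prob_space K using prob_space_coupling[OF \<mu>(1) K] .
  have setsK: "sets K = sets (\<mu> \<Otimes>\<^sub>M \<nu>)" and dfst: "distr K \<mu> fst = \<mu>" and dsnd: "distr K \<nu> snd = \<nu>"
    using K by (auto simp: is_coupling_def)
  define h where "h c = (\<lambda>\<eta>. g (\<lambda>j. if j < Suc i then (\<sigma>(i := c)) j else \<eta> j))" for c
  have fst_K: "fst \<in> measurable K \<mu>" and snd_K: "snd \<in> measurable K \<nu>"
    using measurable_cong_sets[OF setsK refl] measurable_fst measurable_snd by blast+
  have coord: "(\<lambda>\<eta>. \<eta> j) \<in> measurable M (count_space UNIV)"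
    if "j \<ge> Suc i" "sets M = sets (futureM (Suc i))" for j and M :: "(nat \<Rightarrow> 'a) measure"
    using that measurable_cong_sets[OF that(2) refl, of "count_space UNIV :: 'a measure"]
    by (auto simp: futureM_def intro!: measurable_component_singleton)
  have h_meas: "h c \<in> borel_measurable M"
    if "sets M = sets (futureM (Suc i))" for c and M :: "(nat \<Rightarrow> 'a) measure"
    unfolding h_def
  proof (rule measurable_depends_below[OF g])
    show "(\<lambda>\<eta>. if j < Suc i then (\<sigma>(i := c)) j else \<eta> j) \<in> measurable M (count_space UNIV)" for j
      using coord[of j M] that by (cases "j < Suc i") auto
  qed simp
  have coord_fst: "(\<lambda>p. fst p k) \<in> measurable K (count_space UNIV)" if "k > i" for k
    using measurable_compose[OF fst_K coord[OF _ \<mu>(2), of k]] that by simp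
  have coord_snd: "(\<lambda>p. snd p k) \<in> measurable K (count_space UNIV)" if "k > i" for k
    using measurable_compose[OF snd_K coord[OF _ \<nu>(2), of k]] that by simp
  define N where "N k = {p \<in> space K. fst p k \<noteq> snd p k}" for k
  have N: "N k \<in> sets K" if "k > i" for k
  proof -
    have "{p \<in> space K. fst p k = snd p k} \<in> sets K"
      using coord_fst[OF that] coord_snd[OF that] by measurable
    then have "space K - {p \<in> space K. fst p k = snd p k} \<in> sets K" by blast
    also have "space K - {p \<in> space K. fst p k = snd p k} = N k" by (auto simp: N_def)
    finally show ?thesis .
  qed
  obtain B where B: "\<And>\<sigma>. \<bar>g \<sigma>\<bar> \<le> B" using depends_below_abs_bound[OF g] by blast
  have int_fst: "integrable K (\<lambda>p. h a (fst p))"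
    using measurable_compose[OF fst_K h_meas[OF \<mu>(2)]] B
    by (intro K.integrable_const_bound[of _ B]) (auto simp: h_def)
  have int_snd: "integrable K (\<lambda>p. h b (snd p))"
    using measurable_compose[OF snd_K h_meas[OF \<nu>(2)]] B
    by (intro K.integrable_const_bound[of _ B]) (auto simp: h_def)
  have int_ind: "integrable K (\<lambda>p. indicator (N k) p * variation g k)" if "k > i" for k
    using N[OF that] by (intro integrable_mult_left integrable_real_indicator) (auto simp: K.emeasure_eq_measure)
  have "(\<integral>\<eta>. h a \<eta> \<partial>\<mu>) - (\<integral>\<eta>. h b \<eta> \<partial>\<nu>) = (\<integral>p. h a (fst p) \<partial>K) - (\<integral>p. h b (snd p) \<partial>K)"
    using integral_distr[OF fst_K h_meas[OF \<mu>(2)], of a] integral_distr[OF snd_K h_meas[OF \<nu>(2)], of b]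
    by (simp add: dfst dsnd)
  also have "\<dots> = (\<integral>p. h a (fst p) - h b (snd p) \<partial>K)"
    using int_fst int_snd by simp
  also have "\<dots> \<le> (\<integral>p. variation g i + (\<Sum>k\<in>{i<..<n}. indicator (N k) p * variation g k) \<partial>K)"
  proof (rule integral_mono)
    fix p assume p: "p \<in> space K"
    define x where "x = (\<lambda>j. if j < Suc i then (\<sigma>(i := a)) j else fst p j)"
    define y where "y = (\<lambda>j. if j < Suc i then (\<sigma>(i := b)) j else snd p j)"
    have "h a (fst p) - h b (snd p) \<le> (\<Sum>k<n. variation g k * of_bool (x k \<noteq> y k))"
      unfolding h_def x_def y_def by (rule diff_le_sum_variation[OF g])
    \<comment> \<open>Both sequences carry the past of \<sigma> strictly before
      \<open>i\<close>.\<close>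
    also have "\<dots> = (\<Sum>k\<in>{i..<n}. variation g k * of_bool (x k \<noteq> y k))"
      by (rule sum.mono_neutral_right) (auto simp: x_def y_def)
    also have "\<dots> = variation g i * of_bool (x i \<noteq> y i) + (\<Sum>k\<in>{i<..<n}. variation g k * of_bool (x k \<noteq> y k))"
      using \<open>i < n\<close> by (simp only: sum.atLeast_Suc_lessThan atLeastSucLessThan_greaterThanLessThan)
    also have "\<dots> \<le> variation g i + (\<Sum>k\<in>{i<..<n}. indicator (N k) p * variation g k)"
      using variation_nonneg[OF g] p
      by (intro add_mono sum_mono) (auto simp: N_def x_def y_def indicator_def of_bool_def)
    finally show "h a (fst p) - h b (snd p) \<le> \<dots>" .
  next
    show "integrable K (\<lambda>p. h a (fst p) - h b (snd p))"
      using int_fst int_snd by (rule Bochner_Integration.integrable_diff)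
    show "integrable K (\<lambda>p. variation g i + (\<Sum>k\<in>{i<..<n}. indicator (N k) p * variation g k))"
      by (intro Bochner_Integration.integrable_add K.integrable_const Bochner_Integration.integrable_sum int_ind)
        simp
  qed
  also have "\<dots> = variation g i + (\<Sum>k\<in>{i<..<n}. measure K (N k) * variation g k)"
  proof -
    have int: "integrable K (\<lambda>p. indicator (N k) p * variation g k)" if "k \<in> {i<..<n}" for k
      using int_ind that by simp
    have "N k \<inter> space K = N k" for k
      by (auto simp: N_def)
    then have ind: "(\<integral>p. indicator (N k) p * variation g k \<partial>K) = measure K (N k) * variation g k" for k
      by simp
    have "(\<integral>p. variation g i + (\<Sum>k\<in>{i<..<n}. indicator (N k) p * variation g k) \<partial>K)
      = (\<integral>p. variation g i \<partial>K) + (\<integral>p. (\<Sum>k\<in>{i<..<n}. indicator (N k) p * variation g k) \<partial>K)"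
      by (rule Bochner_Integration.integral_add[OF K.integrable_const Bochner_Integration.integrable_sum[OF int]])
    also have "(\<integral>p. (\<Sum>k\<in>{i<..<n}. indicator (N k) p * variation g k) \<partial>K) =
        (\<Sum>k\<in>{i<..<n}. measure K (N k) * variation g k)"
      by (subst Bochner_Integration.integral_sum[OF int]) (simp_all only: ind)
    finally show ?thesis
      by (simp only: lebesgue_integral_const K.prob_space scaleR_one)
  qed
  finally show ?thesis by (simp add: h_def N_def)
qed

text \<open>Couplings are probability measures, so all entries are at most 1 and the supremum over
  pasts is a genuine upper bound.\<close>

lemma coupling_matrix_le_sup:
  assumes Q: "cond_future_versions P Q" and C: "maximal_coupling_choice Q C"
  shows "coupling_matrix C \<sigma> i k \<le> sup_coupling_matrix C i k"
  unfolding sup_coupling_matrix_def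
proof (rule cSUP_upper)
  have "measure (C i \<sigma> a b) S \<le> 1" for \<sigma> a b S
  proof -
    have "is_coupling (Q (Suc i) (\<sigma>(i := a))) (Q (Suc i) (\<sigma>(i := b))) (C i \<sigma> a b)"
      using C by (auto simp: maximal_coupling_choice_def is_maximal_coupling_def)
    moreover have "prob_space (Q (Suc i) (\<sigma>(i := a)))"
      using Q by (auto simp: cond_future_versions_def)
    ultimately show ?thesis by (rule prob_space.prob_le_1[OF prob_space_coupling, rotated])
  qed
  then have "coupling_matrix C \<sigma> i k \<le> 1" for \<sigma>
    by (auto simp: coupling_matrix_def)
  then show "bdd_above (range (\<lambda>\<sigma>. coupling_matrix C \<sigma> i k))"
    by (auto simp: bdd_above_def)
qed simp

text \<open>The diagonal entry 1 pays for the changed letter at \<open>i\<close>, and the entries to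
  its right bound the disagreement probabilities of the coupled futures. Passing to the supremum
  makes the bound independent of \<sigma>.\<close>

lemma (in seq_prob_space) cond_mean_oscillation:
  assumes Q: "cond_future_versions P Q" and C: "maximal_coupling_choice Q C"
    and g: "depends_below n g" and "i < n"
    and pos: "prob (cylinder (Suc i) (\<sigma>(i := a))) > 0" "prob (cylinder (Suc i) (\<sigma>(i := b))) > 0"
  shows "cond_mean P g (Suc i) (\<sigma>(i := a)) - cond_mean P g (Suc i) (\<sigma>(i := b))
    \<le> mat_apply (sup_coupling_matrix C) (variation g) i"
proof -
  let ?K = "C i \<sigma> a b"
  have K: "is_coupling (Q (Suc i) (\<sigma>(i := a))) (Q (Suc i) (\<sigma>(i := b))) ?K"
    using C by (auto simp: maximal_coupling_choice_def is_maximal_coupling_def)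
  have pQ: "prob_space (Q (Suc i) \<tau>)" and sQ: "sets (Q (Suc i) \<tau>) = sets (futureM (Suc i))" for \<tau>
    using Q by (auto simp: cond_future_versions_def)
  have "cond_mean P g (Suc i) (\<sigma>(i := a)) - cond_mean P g (Suc i) (\<sigma>(i := b))
    \<le> variation g i + (\<Sum>k\<in>{i<..<n}. measure ?K {p \<in> space ?K. fst p k \<noteq> snd p k} * variation g k)"
    using coupling_integral_diff_le[OF pQ sQ pQ sQ K g \<open>i < n\<close>, of \<sigma> a b]
    by (simp only: integral_future_eq_cond_mean[OF Q g pos(1)] integral_future_eq_cond_mean[OF Q g pos(2)])
  also have "\<dots> \<le> coupling_matrix C \<sigma> i i * variation g i
      + (\<Sum>k\<in>{i<..<n}. coupling_matrix C \<sigma> i k * variation g k)"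
  proof (intro add_mono sum_mono mult_right_mono variation_nonneg[OF g])
    fix k assume "k \<in> {i<..<n}"
    then have "coupling_matrix C \<sigma> i k = Max (range (\<lambda>(a, b).
             measure (C i \<sigma> a b) {p \<in> space (C i \<sigma> a b). fst p k \<noteq> snd p k}))"
      by (simp add: coupling_matrix_def)
    also have "\<dots> \<ge> measure ?K {p \<in> space ?K. fst p k \<noteq> snd p k}"
      by (rule Max_ge) (auto simp: image_iff)
    finally show "measure ?K {p \<in> space ?K. fst p k \<noteq> snd p k} \<le> coupling_matrix C \<sigma> i k" .
  qed (simp add: coupling_matrix_def)
  also have "\<dots> = (\<Sum>k\<in>{i..<n}. coupling_matrix C \<sigma> i k * variation g k)"
    using \<open>i < n\<close> by (simp add: sum.atLeast_Suc_lessThan atLeastSucLessThan_greaterThanLessThan)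
  \<comment> \<open>The added terms vanish by triangularity; likewise the series in
    \<open>mat_apply\<close> stops at \<open>n\<close> because later variations are 0.\<close>
  also have "\<dots> = (\<Sum>k<n. coupling_matrix C \<sigma> i k * variation g k)"
    by (rule sum.mono_neutral_left) (auto simp: coupling_matrix_def)
  also have "\<dots> \<le> (\<Sum>k<n. sup_coupling_matrix C i k * variation g k)"
    by (intro sum_mono mult_right_mono coupling_matrix_le_sup[OF Q C] variation_nonneg[OF g])
  also have "\<dots> = mat_apply (sup_coupling_matrix C) (variation g) i"
    unfolding mat_apply_def
    by (rule suminf_finite[symmetric]) (auto simp: variation_eq_0[OF g])
  finally show ?thesis .
qed

subsection \<open>The operator norm\<close>

lemma l2_norm_mult:
  assumes "u \<in> l2"
  shows "l2_norm (\<lambda>i. c * u i) = \<bar>c\<bar> * l2_norm u"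
  using assms by (simp add: l2_norm_def l2_def power_mult_distrib suminf_mult real_sqrt_mult)

text \<open>The operator norm is a supremum over unit vectors, so \<open>u\<close> is first scaled
  to norm 1. Boundedness supplies the summability that lets the scalar leave the series, and makes
  the supremum an upper bound.\<close>

lemma l2_norm_mat_apply_le:
  assumes M: "l2_bounded M" and u: "u \<in> l2" "l2_norm u > 0"
  shows "l2_norm (mat_apply M u) \<le> l2_opnorm M * l2_norm u"
proof -
  define v where "v = (\<lambda>i. inverse (l2_norm u) * u i)"
  have v: "v \<in> l2" "l2_norm v = 1"
    using u by (auto simp: v_def l2_norm_mult) (auto simp: l2_def power_mult_distrib intro!: summable_mult)
  have "mat_apply M v = (\<lambda>i. inverse (l2_norm u) * mat_apply M u i)"
  proof
    fix i
    have "(\<Sum>j. inverse (l2_norm u) * (M i j * u j)) = inverse (l2_norm u) * (\<Sum>j. M i j * u j)"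
      using M u(1) by (intro suminf_mult) (auto simp: l2_bounded_def)
    then show "mat_apply M v i = inverse (l2_norm u) * mat_apply M u i"
      by (simp add: mat_apply_def v_def mult_ac)
  qed
  then have "l2_norm (mat_apply M v) = inverse (l2_norm u) * l2_norm (mat_apply M u)"
    using M u by (simp add: l2_norm_mult l2_bounded_def)
  moreover have "l2_norm (mat_apply M v) \<le> l2_opnorm M"
    unfolding l2_opnorm_def using M v by (intro cSup_upper) (auto simp: l2_bounded_def)
  ultimately have "inverse (l2_norm u) * l2_norm (mat_apply M u) \<le> l2_opnorm M" by simp
  then show ?thesis using u(2) by (simp add: field_simps)
qed

subsection \<open>The concentration inequality\<close>

lemma (in seq_prob_space) upper_tail_bound:
  assumes g: "depends_below n g" and t: "t > 0" and S: "S > 0" "(\<Sum>i<n. (c i)\<^sup>2) \<le> S"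
    and osc: "\<And>i \<sigma> a b. i < n \<Longrightarrow> prob (cylinder (Suc i) (\<sigma>(i := a))) > 0 \<Longrightarrow>
      prob (cylinder (Suc i) (\<sigma>(i := b))) > 0 \<Longrightarrow>
      cond_mean P g (Suc i) (\<sigma>(i := a)) - cond_mean P g (Suc i) (\<sigma>(i := b)) \<le> c i"
  shows "prob {\<sigma> \<in> space P. g \<sigma> - expectation g \<ge> t} \<le> exp (- (2 * t\<^sup>2 / S))"
proof -
  \<comment> \<open>This \<open>l\<close> minimises the Chernoff exponent
    \<open>l\<^sup>2 * S / 8 - l * t\<close>, with minimum
    \<open>- (2 * t\<^sup>2 / S)\<close>.\<close>
  define l where "l = 4 * t / S"
  have l: "l > 0" using t S by (simp add: l_def)
  let ?f = "\<lambda>\<eta>. exp (l * (g \<eta> - expectation g))"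
  \<comment> \<open>With an empty past the cylinder is the whole space, so the bound at
    \<open>m = 0\<close> concerns the plain expectation.\<close>
  have cyl0: "cylinder 0 \<sigma> = UNIV" for \<sigma> :: "nat \<Rightarrow> 'a"
    by (simp add: cylinder_def agree_below_def)
  have p0: "prob UNIV = 1" using prob_space by (simp add: space_P)
  have "expectation ?f \<le> exp (l\<^sup>2 * (\<Sum>i<n. (c i)\<^sup>2) / 8)"
    using mgf_cylinder_bound[OF g l osc, where m = 0]
    by (simp add: cyl0 cond_mean_def p0 atLeast0LessThan)
  also have "\<dots> \<le> exp (l\<^sup>2 * S / 8)"
    using S by (simp add: mult_left_mono)
  finally have mgf: "expectation ?f \<le> exp (l\<^sup>2 * S / 8)" .
  have dep: "depends_below n ?f" using g by (auto simp: depends_below_def)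
  have "{\<sigma> \<in> space P. g \<sigma> - expectation g \<ge> t} = {\<sigma> \<in> space P. ?f \<sigma> \<ge> exp (l * t)}"
    using l by simp
  also have "prob \<dots> \<le> expectation ?f / exp (l * t)"
    by (intro integral_Markov_inequality_measure[where A = "{}"] integrable_P[OF dep]) auto
  also have "\<dots> \<le> exp (l\<^sup>2 * S / 8) / exp (l * t)"
    using mgf by (simp add: divide_right_mono)
  also have "\<dots> = exp (l\<^sup>2 * S / 8 - l * t)"
    by (simp add: exp_diff)
  also have "l\<^sup>2 * S / 8 - l * t = - (2 * t\<^sup>2 / S)"
    using S by (simp add: l_def field_simps power2_eq_square)
  finally show ?thesis .
qed

theorem theorem1:
  fixes P :: "(nat \<Rightarrow> 'a::finite) measure"
    and Q :: "nat \<Rightarrow> (nat \<Rightarrow> 'a) \<Rightarrow> (nat \<Rightarrow> 'a) measure"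
    and C :: "nat \<Rightarrow> (nat \<Rightarrow> 'a) \<Rightarrow> 'a \<Rightarrow> 'a \<Rightarrow> ((nat \<Rightarrow> 'a) \<times> (nat \<Rightarrow> 'a)) measure"
    and g :: "(nat \<Rightarrow> 'a) \<Rightarrow> real"
    and n :: nat
    and t :: real
  assumes "prob_space P"
    and "sets P = sets seqM"
    and "cond_future_versions P Q"
    and "maximal_coupling_choice Q C"
    and "l2_bounded (sup_coupling_matrix C)"
    and "n \<ge> 1"
    and "depends_below n g"
    and "t > 0"
  shows "measure P {\<sigma> \<in> space P. \<bar>g \<sigma> - (\<integral>\<eta>. g \<eta> \<partial>P)\<bar> \<ge> t}
    \<le> 2 * (if l2_norm (variation g) = 0 then 0
            else exp (- (2 * t\<^sup>2 /
              ((l2_opnorm (sup_coupling_matrix C))\<^sup>2 * (l2_norm (variation g))\<^sup>2))))"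
proof -
  interpret seq_prob_space P
    using assms by (simp add: seq_prob_space_def seq_prob_space_axioms_def)
  note Q = assms(3) and C = assms(4) and D = assms(5) and g = assms(7) and t = assms(8)
  let ?D = "sup_coupling_matrix C"
  define S where "S = (l2_opnorm ?D)\<^sup>2 * (l2_norm (variation g))\<^sup>2"
  have var_summable: "summable (\<lambda>i. (variation g i)\<^sup>2)"
    by (rule summable_finite[of "{..<n}"]) (auto simp: variation_eq_0[OF g])
  show ?thesis
  proof (cases "l2_norm (variation g) = 0")
    case True
    then have "variation g i = 0" for i
      using var_summable by (simp add: l2_norm_def suminf_eq_zero_iff)
    \<comment> \<open>Without variation \<open>g\<close> is constant, so the event is empty because
      \<open>t > 0\<close>.\<close>
    then have le: "g x \<le> g y" for x y
      using diff_le_sum_variation[OF g, of x y] by simp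
    define c where "c = g undefined"
    have "g x = c" for x
      unfolding c_def by (rule antisym; rule le)
    then show ?thesis using t True by (simp add: prob_space)
  next
    case False
    have norm_pos: "l2_norm (variation g) > 0"
      using False var_summable by (simp add: l2_norm_def order_less_le suminf_nonneg)
    have "prob {\<sigma> \<in> space P. \<bar>g \<sigma> - expectation g\<bar> \<ge> t} \<le> 2 * exp (- (2 * t\<^sup>2 / S))"
    \<comment> \<open>If \<open>S = 0\<close>, division by zero yields 0, the exponential is 1 and
      the bound 2 is trivial. This avoids having to bound the operator norm away from 0.\<close>
    proof (cases "S = 0")
      case True
      have "prob {\<sigma> \<in> space P. \<bar>g \<sigma> - expectation g\<bar> \<ge> t} \<le> 1" by (rule prob_le_1)
      also have "\<dots> \<le> 2 * exp (- (2 * t\<^sup>2 / S))" by (simp add: True)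
      finally show ?thesis .
    next
      case S: False
      then have S_pos: "S > 0" by (simp add: S_def order_less_le)
      define c where "c = mat_apply ?D (variation g)"
      have var_l2: "variation g \<in> l2" using var_summable by (simp add: l2_def)
      \<comment> \<open>The matrix applied to the variations lies in \<open>l2\<close>, so its
        partial sums of squares stay below the squared norm.\<close>
      have "(\<Sum>i<n. (c i)\<^sup>2) \<le> (l2_norm c)\<^sup>2"
        using D var_l2 unfolding l2_norm_def c_def
        by (subst real_sqrt_pow2) (auto simp: l2_bounded_def l2_def intro!: suminf_nonneg sum_le_suminf)
      also have "\<dots> \<le> S"
        unfolding S_def c_def power_mult_distrib[symmetric]
        using l2_norm_mat_apply_le[OF D var_l2 norm_pos] D var_l2
        by (intro power_mono)
           (auto simp: l2_norm_def l2_bounded_def l2_def intro!: suminf_nonneg real_sqrt_ge_zero)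
      finally have cS: "(\<Sum>i<n. (c i)\<^sup>2) \<le> S" .
      \<comment> \<open>The lower tail of \<open>g\<close> is the upper tail of \<open>- g\<close>,
        which has the same variations; the union bound over the two tails gives the factor
        2.\<close>
      have g': "depends_below n (\<lambda>\<sigma>. - g \<sigma>)" using g by (simp add: depends_below_def)
      have up: "prob {\<sigma> \<in> space P. g \<sigma> - expectation g \<ge> t} \<le> exp (- (2 * t\<^sup>2 / S))"
        using cond_mean_oscillation[OF Q C g]
        by (intro upper_tail_bound[OF g t S_pos cS]) (simp add: c_def)
      have low: "prob {\<sigma> \<in> space P. - g \<sigma> - expectation (\<lambda>\<sigma>. - g \<sigma>) \<ge> t} \<le> exp (- (2 * t\<^sup>2 / S))"
        using cond_mean_oscillation[OF Q C g']
        by (intro upper_tail_bound[OF g' t S_pos cS]) (simp add: c_def variation_uminus)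
      have meas: "g \<in> borel_measurable P" by (rule borel_measurable_P[OF g])
      have "{\<sigma> \<in> space P. \<bar>g \<sigma> - expectation g\<bar> \<ge> t} =
          {\<sigma> \<in> space P. g \<sigma> - expectation g \<ge> t} \<union> {\<sigma> \<in> space P. - g \<sigma> - expectation (\<lambda>\<sigma>. - g \<sigma>) \<ge> t}"
        by auto
      also have "prob \<dots> \<le> prob {\<sigma> \<in> space P. g \<sigma> - expectation g \<ge> t}
          + prob {\<sigma> \<in> space P. - g \<sigma> - expectation (\<lambda>\<sigma>. - g \<sigma>) \<ge> t}"
        using meas by (intro measure_Un_le) auto
      also have "\<dots> \<le> 2 * exp (- (2 * t\<^sup>2 / S))" using up low by simp
      finally show ?thesis .
    qed
    then show ?thesis using False by (simp add: S_def)
  qed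
qed

end
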